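(* Let $X$ be a coset space of a completely metrizable topological group $G$. Then $X$ is a coset space of a completely metrizable subgroup $H$ of $G$ with $w(H)\le w(X)$.
   Context: All spaces (including topological groups) are Tychonoff. A space $X$ is a coset space of a topological group $G$ if $X$ is homeomorphic to $G/K$ (with the quotient topology) for some closed subgroup $K\subset G$. Subgroups carry the subspace topology. $w(\cdot)$ denotes the weight of a space, i.e. the least cardinality of a base of its topology.
   Formalization: For finite X the bound w(H) ≤ w(X) is replaced by w(H) ≤ ℵ₀ (weights read as infinite cardinals), since the literal claim fails there: G = ℤ, K = 2ℤ gives w(X) = 2, but every suitable H is infinite discrete. *)

theory Defs
  imports "HOL-Analysis.Analysis" "HOL-Algebra.Left_Coset"
begin

unbundle cardinal_syntax

definition tychonoff_space :: "'a topology \<Rightarrow> bool"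
  where "tychonoff_space X \<longleftrightarrow> completely_regular_space X \<and> Hausdorff_space X"

text \<open>Following the standing convention that all spaces, including topological groups, are
  Tychonoff, this is part of the definition of a topological group.\<close>

locale topological_group = group G for G :: "('a, 'm) monoid_scheme" (structure) +
  fixes T :: "'a topology"
  assumes topspace_eq_carrier: "topspace T = carrier G"
    and tychonoff: "tychonoff_space T"
    and continuous_mult: "continuous_map (prod_topology T T) T (\<lambda>(x, y). x \<otimes> y)"
    and continuous_inv: "continuous_map T T (\<lambda>x. inv x)"

text \<open>The quotient topology on the set of left cosets \<open>xK\<close>.\<close>

definition coset_topology :: "('a, 'm) monoid_scheme \<Rightarrow> 'a topology \<Rightarrow> 'a set \<Rightarrow> 'a set topology"
  where "coset_topology G T K =
    topology (\<lambda>U. U \<subseteq> lcosets\<^bsub>G\<^esub> K \<and> openin T {x \<in> topspace T. x <#\<^bsub>G\<^esub> K \<in> U})"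

lemma openin_coset_topology:
  "openin (coset_topology G T K) U \<longleftrightarrow>
    U \<subseteq> lcosets\<^bsub>G\<^esub> K \<and> openin T {x \<in> topspace T. x <#\<^bsub>G\<^esub> K \<in> U}"
proof -
  let ?P = "\<lambda>U. U \<subseteq> lcosets\<^bsub>G\<^esub> K \<and> openin T {x \<in> topspace T. x <#\<^bsub>G\<^esub> K \<in> U}"
  have "istopology ?P"
    unfolding istopology_def
  proof (intro conjI allI impI)
    fix S S' assume "?P S" "?P S'"
    moreover have "{x \<in> topspace T. x <#\<^bsub>G\<^esub> K \<in> S \<inter> S'} =
        {x \<in> topspace T. x <#\<^bsub>G\<^esub> K \<in> S} \<inter> {x \<in> topspace T. x <#\<^bsub>G\<^esub> K \<in> S'}"
      by blast
    ultimately show "S \<inter> S' \<subseteq> lcosets\<^bsub>G\<^esub> K" "openin T {x \<in> topspace T. x <#\<^bsub>G\<^esub> K \<in> S \<inter> S'}"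
      by (auto intro: openin_Int)
  next
    fix \<K> assume *: "\<forall>S\<in>\<K>. ?P S"
    have "{x \<in> topspace T. x <#\<^bsub>G\<^esub> K \<in> \<Union>\<K>} = (\<Union>S\<in>\<K>. {x \<in> topspace T. x <#\<^bsub>G\<^esub> K \<in> S})"
      by blast
    with * show "\<Union>\<K> \<subseteq> lcosets\<^bsub>G\<^esub> K" "openin T {x \<in> topspace T. x <#\<^bsub>G\<^esub> K \<in> \<Union>\<K>}"
      by auto
  qed
  then show ?thesis
    by (simp add: coset_topology_def topology_inverse')
qed

lemma (in topological_group) topspace_coset_topology:
  "topspace (coset_topology G T K) = lcosets K"
proof
  show "topspace (coset_topology G T K) \<subseteq> lcosets K"
    by (meson openin_coset_topology openin_topspace)
  have "{x \<in> topspace T. x <# K \<in> lcosets K} = topspace T"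
    by (auto simp: topspace_eq_carrier LCOSETS_def)
  then have "openin (coset_topology G T K) (lcosets K)"
    by (simp add: openin_coset_topology)
  then show "lcosets K \<subseteq> topspace (coset_topology G T K)"
    by (rule openin_subset)
qed

lemma (in topological_group) quotient_map_coset_topology:
  "quotient_map T (coset_topology G T K) (\<lambda>x. x <# K)"
  unfolding quotient_map_def topspace_coset_topology
  by (auto simp: openin_coset_topology topspace_eq_carrier LCOSETS_def)

definition coset_space_of :: "'b topology \<Rightarrow> ('a, 'm) monoid_scheme \<Rightarrow> 'a topology \<Rightarrow> bool"
  where "coset_space_of X G T \<longleftrightarrow>
    (\<exists>K. subgroup K G \<and> closedin T K \<and> X homeomorphic_space coset_topology G T K)"

definition topology_base :: "'a topology \<Rightarrow> 'a set set \<Rightarrow> bool"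
  where "topology_base X \<B> \<longleftrightarrow> openin X = arbitrary union_of (\<lambda>U. U \<in> \<B>)"

text \<open>The weight is represented, as usual in the cardinals library, by a wellorder of minimal order
  type, so weights of spaces of different types are compared by \<open>\<le>o\<close>.  It is literally the least
  cardinality of a base; in particular it is finite for finite discrete spaces.\<close>

definition weight :: "'a topology \<Rightarrow> 'a set rel"
  where "weight X = (SOME r. \<exists>\<B>. topology_base X \<B> \<and> r = |\<B>| \<and>
    (\<forall>\<B>'. topology_base X \<B>' \<longrightarrow> |\<B>| \<le>o |\<B>'| ))"

lemma weight:
  shows weight_attained: "\<exists>\<B>. topology_base X \<B> \<and> weight X = |\<B>|"
    and weight_least: "topology_base X \<B>' \<Longrightarrow> weight X \<le>o |\<B>'|"
proof -
  define R :: "'a set rel set" where "R = card_of ` {\<B>. topology_base X \<B>}"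
  have "topology_base X {U. openin X U}"
    unfolding topology_base_def
    by (rule ext) (metis arbitrary_union_of_alt mem_Collect_eq openin_subopen)
  then have "R \<noteq> {}" by (auto simp: R_def)
  moreover have "\<forall>r\<in>R. Card_order r"
    by (simp add: R_def card_of_Card_order)
  ultimately obtain r where "r \<in> R" and least: "\<forall>r'\<in>R. r \<le>o r'"
    using exists_minim_Card_order[of R] by auto
  from \<open>r \<in> R\<close> obtain \<B> where "topology_base X \<B>" "r = |\<B>|"
    by (auto simp: R_def)
  moreover have "|\<B>| \<le>o |\<B>'|" if "topology_base X \<B>'" for \<B>'
    using least that \<open>r = |\<B>|\<close> by (simp add: R_def)
  ultimately have "\<exists>r \<B>. topology_base X \<B> \<and> r = |\<B>| \<and>
      (\<forall>\<B>'. topology_base X \<B>' \<longrightarrow> |\<B>| \<le>o |\<B>'| )"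
    by (intro exI[of _ r] exI[of _ \<B>] conjI allI impI)
  then have *: "\<exists>\<B>. topology_base X \<B> \<and> weight X = |\<B>| \<and>
      (\<forall>\<B>'. topology_base X \<B>' \<longrightarrow> |\<B>| \<le>o |\<B>'| )"
    unfolding weight_def by (rule someI_ex)
  then obtain \<B>0 where B0: "topology_base X \<B>0" "weight X = |\<B>0|"
      "\<forall>\<B>'. topology_base X \<B>' \<longrightarrow> |\<B>0| \<le>o |\<B>'|"
    by (elim exE conjE)
  from B0(1,2) show "\<exists>\<B>. topology_base X \<B> \<and> weight X = |\<B>|"
    by (intro exI conjI)
  show "weight X \<le>o |\<B>'|" if "topology_base X \<B>'"
    using B0(3)[rule_format, OF that] unfolding B0(2) .
qed

end

theory Submission
  imports Defs
begin

text \<open>Write \<open>\<phi>\<close> for the projection of \<open>G\<close> onto \<open>X = G/K\<close>.  It suffices to find a closed subgroup \<open>H\<close>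
  with a dense subset of cardinality at most \<open>max (w X) \<aleph>\<^sub>0\<close> such that \<open>\<phi>\<close> restricted to \<open>H\<close> is still open
  and onto: then \<open>H/(H \<inter> K)\<close> and \<open>G/K\<close> are quotients of \<open>H\<close> with the same fibres, hence homeomorphic, and
  in the metrizable space \<open>H\<close> the weight is bounded by the size of a dense subset times \<open>\<aleph>\<^sub>0\<close>.

  The small dense set comes from the action of \<open>G\<close> on \<open>X\<close>.  Fix a base \<open>\<B>\<close> of \<open>X\<close> of size \<open>w X\<close> and a
  countable neighbourhood base \<open>V\<^sub>n\<close> of \<open>\<one>\<close>.  For all \<open>n\<close> and \<open>A, A' \<in> \<B>\<close> such that some \<open>g \<in> V\<^sub>n\<close> maps \<open>A\<close>
  into \<open>A'\<close>, choose one such \<open>g\<close>.  The chosen elements form a set \<open>D\<close> for which \<open>(D \<inter> V\<^sub>n) x\<close> is dense in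
  \<open>V\<^sub>n x\<close> for every point \<open>x\<close> of \<open>X\<close> at once (\<open>small_pointwise_dense_family\<close>).  Let \<open>H\<close> be the closure of
  the subgroup generated by \<open>D\<close>.

  Density has to be turned into equality, and this is where completeness enters.  The argument is the one
  behind open mapping theorems for group actions in the style of Effros and Ancel
  (\<open>weakly_microtransitive_imp_microtransitive\<close>): if \<open>y\<close> lies in \<open>V x\<close> for a small \<open>V\<close>, elements of \<open>H\<close>
  are used to move alternately \<open>x\<close> towards the current image of \<open>y\<close> and \<open>y\<close> towards the current image of
  \<open>x\<close>.  The two sequences of accumulated products converge in \<open>H\<close> to \<open>p\<close> and \<open>s\<close> near \<open>\<one>\<close> with
  \<open>p x = s y\<close>, so \<open>s\<^sup>-\<^sup>1 p\<close> is an element of \<open>H\<close> near \<open>\<one>\<close> that carries \<open>x\<close> to \<open>y\<close>.  Moving both points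
  is essential: a completely metrizable group may have no complete left-invariant metric, but each step here
  multiplies an accumulated product on the left, and it can be made small for any complete metric because
  the next neighbourhood is chosen once the product is known.\<close>

section \<open>Cardinality and weight\<close>

text \<open>Closing off under \<open>a \<otimes> inv b\<close> in countably many rounds, each of which only squares the
  cardinality, does not leave an infinite cardinal.\<close>

lemma card_generated_subgroup:
  assumes G: "group G" and A: "infinite A" and D: "D \<subseteq> carrier G" "|D| \<le>o |A|"
  shows "\<exists>S. subgroup S G \<and> D \<subseteq> S \<and> |S| \<le>o |A|"
proof -
  interpret group G by fact
  define F where "F = rec_nat (insert \<one>\<^bsub>G\<^esub> D) (\<lambda>_ S. (\<lambda>(a, b). a \<otimes>\<^bsub>G\<^esub> inv\<^bsub>G\<^esub> b) ` (S \<times> S))"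
  have F0: "F 0 = insert \<one>\<^bsub>G\<^esub> D"
    and FS: "F (Suc n) = (\<lambda>(a, b). a \<otimes>\<^bsub>G\<^esub> inv\<^bsub>G\<^esub> b) ` (F n \<times> F n)" for n
    by (simp_all add: F_def)
  have F: "F n \<subseteq> carrier G \<and> \<one>\<^bsub>G\<^esub> \<in> F n \<and> |F n| \<le>o |A|" for n
  proof (induction n)
    case 0
    have "|insert \<one>\<^bsub>G\<^esub> D| \<le>o |{\<one>\<^bsub>G\<^esub>} <+> D|"
      using card_of_Un_Plus_ordLeq[of "{\<one>\<^bsub>G\<^esub>}" D] by simp
    moreover have "|{\<one>\<^bsub>G\<^esub>} <+> D| \<le>o |A|"
    proof (rule card_of_Plus_ordLeq_infinite_Field)
      show "|{\<one>\<^bsub>G\<^esub>}| \<le>o |A|"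
        using A by (intro card_of_singl_ordLeq) auto
    qed (use A D in \<open>auto simp: Field_card_of intro: card_of_card_order_on\<close>)
    ultimately show ?case
      using D F0 by (auto intro: ordLeq_transitive)
  next
    case (Suc n)
    have "|F (Suc n)| \<le>o |F n \<times> F n|"
      unfolding FS by (rule card_of_image)
    moreover have "|F n \<times> F n| \<le>o |A|"
      using Suc A by (intro card_of_Times_ordLeq_infinite_Field) (auto simp: Field_card_of intro: card_of_card_order_on)
    moreover have "\<one>\<^bsub>G\<^esub> \<in> F (Suc n)"
      unfolding FS using Suc by (intro image_eqI[where x = "(\<one>\<^bsub>G\<^esub>, \<one>\<^bsub>G\<^esub>)"]) auto
    moreover have "F (Suc n) \<subseteq> carrier G"
      unfolding FS using Suc by auto
    ultimately show ?case
      using ordLeq_transitive by blast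
  qed
  have "F n \<subseteq> F (Suc n)" for n
  proof
    fix a assume "a \<in> F n"
    then show "a \<in> F (Suc n)"
      unfolding FS using F[of n] by (intro image_eqI[where x = "(a, \<one>\<^bsub>G\<^esub>)"]) auto
  qed
  then have mono: "F m \<subseteq> F n" if "m \<le> n" for m n
    using that by (rule lift_Suc_mono_le)
  have div: "a \<otimes>\<^bsub>G\<^esub> inv\<^bsub>G\<^esub> b \<in> (\<Union>n. F n)" if ab: "a \<in> (\<Union>n. F n)" "b \<in> (\<Union>n. F n)" for a b
  proof -
    obtain m n where "a \<in> F m" "b \<in> F n"
      using ab by blast
    then have "a \<in> F (max m n)" "b \<in> F (max m n)"
      using mono[of m "max m n"] mono[of n "max m n"] by auto
    then have "a \<otimes>\<^bsub>G\<^esub> inv\<^bsub>G\<^esub> b \<in> F (Suc (max m n))"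
      unfolding FS by (intro image_eqI[where x = "(a, b)"]) auto
    then show ?thesis
      by blast
  qed
  have one: "\<one>\<^bsub>G\<^esub> \<in> (\<Union>n. F n)" and sub: "(\<Union>n. F n) \<subseteq> carrier G"
    using F by auto
  have inv: "inv\<^bsub>G\<^esub> b \<in> (\<Union>n. F n)" if b: "b \<in> (\<Union>n. F n)" for b
    using div[OF one b] subsetD[OF sub b] by simp
  have mult: "a \<otimes>\<^bsub>G\<^esub> b \<in> (\<Union>n. F n)" if a: "a \<in> (\<Union>n. F n)" and b: "b \<in> (\<Union>n. F n)" for a b
    using div[OF a inv[OF b]] subsetD[OF sub b] by simp
  have "subgroup (\<Union>n. F n) G"
    by (rule subgroupI[OF sub _ inv mult]) (use one in auto)
  moreover have "D \<subseteq> (\<Union>n. F n)"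
    using F0 by blast
  moreover have "|\<Union>n. F n| \<le>o |A|"
    using F A by (intro card_of_UNION_ordLeq_infinite) (auto simp flip: infinite_iff_card_of_nat)
  ultimately show ?thesis
    by blast
qed

text \<open>The balls of radius \<open>1/(n+1)\<close> around the points of a dense set form a base.\<close>

lemma weight_le_dense_subset:
  assumes Y: "metrizable_space Y" and dense: "Y closure_of S = topspace Y" and S: "S \<subseteq> topspace Y"
  shows "weight Y \<le>o |(UNIV :: nat set) \<times> S|"
proof -
  obtain M d where "Metric_space M d" and Y: "Y = Metric_space.mtopology M d"
    using Y by (auto simp: metrizable_space_def)
  then interpret Metric_space M d by simp
  let ?ball = "\<lambda>(n, s). mball s (inverse (Suc n))"
  have "topology_base Y (?ball ` (UNIV \<times> S))"
    unfolding topology_base_def openin_topology_base_unique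
  proof (intro conjI allI impI)
    fix V assume "V \<in> ?ball ` (UNIV \<times> S)"
    then show "openin Y V"
      by (auto simp: Y)
  next
    fix U x assume U: "openin Y U \<and> x \<in> U"
    then obtain r where r: "r > 0" "mball x r \<subseteq> U" and x: "x \<in> M"
      unfolding Y openin_mtopology by blast
    obtain n where n: "inverse (real (Suc n)) < r / 2"
      using r reals_Archimedean[of "r / 2"] by auto
    have "x \<in> Y closure_of S"
      using dense x by (simp add: Y)
    then have "\<forall>r>0. \<exists>s\<in>S. s \<in> mball x r"
      unfolding Y metric_closure_of by blast
    moreover have "0 < inverse (real (Suc n))"
      by simp
    ultimately obtain s where s: "s \<in> S" "s \<in> mball x (inverse (Suc n))"
      by blast
    then have sM: "s \<in> M" "d x s < inverse (Suc n)"
      by auto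
    have "mball s (inverse (Suc n)) \<subseteq> mball x r"
    proof
      fix y assume "y \<in> mball s (inverse (Suc n))"
      then have "y \<in> M" "d s y < inverse (Suc n)"
        by auto
      then show "y \<in> mball x r"
        using triangle[of x s y] x sM n by simp
    qed
    then show "\<exists>V. V \<in> ?ball ` (UNIV \<times> S) \<and> x \<in> V \<and> V \<subseteq> U"
      using r s sM x commute[of s x] by (intro exI[of _ "?ball (n, s)"]) auto
  qed
  then have "weight Y \<le>o |?ball ` (UNIV \<times> S)|"
    by (rule weight_least)
  then show ?thesis
    using card_of_image ordLeq_transitive by blast
qed

text \<open>A point is determined by the set of basic open sets that contain it.\<close>

lemma infinite_base:
  assumes X: "Hausdorff_space X" "infinite (topspace X)" and B: "topology_base X \<B>"
  shows "infinite \<B>"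
proof
  assume fin: "finite \<B>"
  have "inj_on (\<lambda>x. {V \<in> \<B>. x \<in> V}) (topspace X)"
  proof (rule inj_onI, rule ccontr)
    fix x y assume xy: "x \<in> topspace X" "y \<in> topspace X"
      and eq: "{V \<in> \<B>. x \<in> V} = {V \<in> \<B>. y \<in> V}" and "x \<noteq> y"
    then obtain U where U: "openin X U" "x \<in> U" "y \<notin> U"
      using X(1) unfolding Hausdorff_space_def disjnt_def by (metis IntI empty_iff)
    then obtain V where "V \<in> \<B>" "x \<in> V" "V \<subseteq> U"
      using B unfolding topology_base_def openin_topology_base_unique by metis
    then show False
      using eq U by blast
  qed
  moreover have "finite ((\<lambda>x. {V \<in> \<B>. x \<in> V}) ` topspace X)"
    by (rule finite_subset[of _ "Pow \<B>"]) (use fin in auto)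
  ultimately show False
    using X(2) finite_imageD by blast
qed

section \<open>Metric and topological preliminaries\<close>

text \<open>The bound on the distance to the limit is what keeps the limits of the back-and-forth
  construction close to \<open>\<one>\<close>.\<close>

lemma (in Metric_space) mcomplete_geometric_limit:
  assumes complete: "mcomplete" and M: "\<And>n. f n \<in> M"
    and step: "\<And>n. d (f n) (f (Suc n)) \<le> e / 2 ^ n"
  obtains l where "limitin mtopology f l sequentially" "d (f 0) l \<le> 2 * e"
proof -
  have dist: "d (f m) (f (m + k)) \<le> 2 * e / 2 ^ m - 2 * e / 2 ^ (m + k)" for m k
  proof (induction k)
    case 0
    then show ?case using M by simp
  next
    case (Suc k)
    have "d (f m) (f (m + Suc k)) \<le> d (f m) (f (m + k)) + d (f (m + k)) (f (Suc (m + k)))"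
      using triangle[OF M[of m] M[of "m + k"] M[of "Suc (m + k)"]] by (simp only: add_Suc_right)
    also have "\<dots> \<le> 2 * e / 2 ^ m - 2 * e / 2 ^ (m + k) + e / 2 ^ (m + k)"
      using Suc step by (intro add_mono)
    also have "\<dots> = 2 * e / 2 ^ m - 2 * e / 2 ^ (m + Suc k)"
      by (simp add: field_simps)
    finally show ?case .
  qed
  have "0 \<le> d (f 0) (f (Suc 0))"
    by (rule nonneg)
  also have "\<dots> \<le> e"
    using step[of 0] by simp
  finally have e: "0 \<le> e" .
  have tail: "d (f m) (f n) \<le> 2 * e / 2 ^ m" if "m \<le> n" for m n
  proof -
    have "d (f m) (f n) \<le> 2 * e / 2 ^ m - 2 * e / 2 ^ n"
      using dist[of m "n - m"] that by simp
    also have "\<dots> \<le> 2 * e / 2 ^ m"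
      using e by simp
    finally show ?thesis .
  qed
  have "MCauchy f"
    unfolding MCauchy_def
  proof (intro conjI allI impI)
    fix \<epsilon> :: real assume \<epsilon>: "0 < \<epsilon>"
    have "(\<lambda>n. 2 * e / 2 ^ n) \<longlonglongrightarrow> 0"
      by (rule LIMSEQ_divide_realpow_zero) simp
    then have "\<forall>\<^sub>F n in sequentially. 2 * e / 2 ^ n < \<epsilon> / 2"
      by (rule order_tendstoD) (use \<epsilon> in simp)
    then obtain N where N: "2 * e / 2 ^ N < \<epsilon> / 2"
      unfolding eventually_sequentially by blast
    have "d (f n) (f n') < \<epsilon>" if "N \<le> n" "N \<le> n'" for n n'
      using triangle[OF M[of n] M[of N] M[of n']] commute[of "f n" "f N"] tail[OF that(1)] tail[OF that(2)] N
      by linarith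
    then show "\<exists>N. \<forall>n n'. N \<le> n \<longrightarrow> N \<le> n' \<longrightarrow> d (f n) (f n') < \<epsilon>"
      by blast
  qed (use M in blast)
  then obtain l where l: "limitin mtopology f l sequentially"
    using complete mcomplete_def by blast
  have "l \<in> mcball (f 0) (2 * e)"
    using l tail[of 0] M by (intro limitin_closedin[OF l]) auto
  then show ?thesis
    using that l by auto
qed

lemma quotient_maps_same_fibres_homeomorphic:
  assumes f: "quotient_map Z X f" and g: "quotient_map Z Y g"
    and fibres: "\<And>a b. a \<in> topspace Z \<Longrightarrow> b \<in> topspace Z \<Longrightarrow> f a = f b \<longleftrightarrow> g a = g b"
  shows "X homeomorphic_space Y"
proof -
  obtain h where h: "continuous_map X Y h" "\<And>z. z \<in> topspace Z \<Longrightarrow> h (f z) = g z"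
    using quotient_map_lift_exists[OF f quotient_imp_continuous_map[OF g]] fibres by metis
  obtain k where k: "continuous_map Y X k" "\<And>z. z \<in> topspace Z \<Longrightarrow> k (g z) = f z"
    using quotient_map_lift_exists[OF g quotient_imp_continuous_map[OF f]] fibres by metis
  have "k (h x) = x" if "x \<in> topspace X" for x
    using that h(2) k(2) quotient_imp_surjective_map[OF f] by (metis imageE)
  moreover have "h (k y) = y" if "y \<in> topspace Y" for y
    using that h(2) k(2) quotient_imp_surjective_map[OF g] by (metis imageE)
  ultimately show ?thesis
    using h(1) k(1) unfolding homeomorphic_space_def homeomorphic_maps_def by blast
qed

section \<open>Topological groups\<close>

context topological_group
begin

lemma continuous_map_group_mult:
  assumes "continuous_map Z T f" "continuous_map Z T g"
  shows "continuous_map Z T (\<lambda>z. f z \<otimes> g z)"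
  using continuous_map_compose[OF continuous_map_pairedI[OF assms] continuous_mult]
  by (simp add: o_def)

lemma continuous_map_group_inv:
  assumes "continuous_map Z T f"
  shows "continuous_map Z T (\<lambda>z. inv (f z))"
  using continuous_map_compose[OF assms continuous_inv] by (simp add: o_def)

lemma continuous_map_left_translate:
  "a \<in> carrier G \<Longrightarrow> continuous_map T T (\<lambda>x. a \<otimes> x)"
  by (intro continuous_map_group_mult) (auto simp: topspace_eq_carrier)

lemma continuous_map_right_translate:
  "a \<in> carrier G \<Longrightarrow> continuous_map T T (\<lambda>x. x \<otimes> a)"
  by (intro continuous_map_group_mult) (auto simp: topspace_eq_carrier)

lemma open_subset_carrier: "openin T U \<Longrightarrow> U \<subseteq> carrier G"
  using openin_subset topspace_eq_carrier by blast

lemma openin_left_preimage: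
  assumes "openin T U" "a \<in> carrier G"
  shows "openin T {x \<in> carrier G. a \<otimes> x \<in> U}"
  using openin_continuous_map_preimage[OF continuous_map_left_translate assms(1)] assms(2)
  by (simp add: topspace_eq_carrier)

lemma openin_right_preimage:
  assumes "openin T U" "a \<in> carrier G"
  shows "openin T {x \<in> carrier G. x \<otimes> a \<in> U}"
  using openin_continuous_map_preimage[OF continuous_map_right_translate assms(1)] assms(2)
  by (simp add: topspace_eq_carrier)

lemma openin_left_translate:
  assumes "openin T U" "a \<in> carrier G"
  shows "openin T ((\<lambda>x. a \<otimes> x) ` U)"
proof -
  have "(\<lambda>x. a \<otimes> x) ` U = {x \<in> carrier G. inv a \<otimes> x \<in> U}"
  proof (intro equalityI subsetI)
    fix x assume "x \<in> {x \<in> carrier G. inv a \<otimes> x \<in> U}"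
    then show "x \<in> (\<lambda>x. a \<otimes> x) ` U"
      using assms(2) by (intro image_eqI[of _ _ "inv a \<otimes> x"]) (auto simp flip: m_assoc)
  next
    fix x assume "x \<in> (\<lambda>x. a \<otimes> x) ` U"
    then obtain u where "u \<in> U" "x = a \<otimes> u" by blast
    then show "x \<in> {x \<in> carrier G. inv a \<otimes> x \<in> U}"
      using assms open_subset_carrier[OF assms(1)] by (auto simp flip: m_assoc)
  qed
  then show ?thesis
    using openin_left_preimage[OF assms(1)] assms(2) by simp
qed

lemma openin_right_translate:
  assumes "openin T U" "a \<in> carrier G"
  shows "openin T ((\<lambda>x. x \<otimes> a) ` U)"
proof -
  have "(\<lambda>x. x \<otimes> a) ` U = {x \<in> carrier G. x \<otimes> inv a \<in> U}"
  proof (intro equalityI subsetI)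
    fix x assume "x \<in> {x \<in> carrier G. x \<otimes> inv a \<in> U}"
    then show "x \<in> (\<lambda>x. x \<otimes> a) ` U"
      using assms(2) by (intro image_eqI[of _ _ "x \<otimes> inv a"]) (auto simp: m_assoc)
  next
    fix x assume "x \<in> (\<lambda>x. x \<otimes> a) ` U"
    then obtain u where "u \<in> U" "x = u \<otimes> a" by blast
    then show "x \<in> {x \<in> carrier G. x \<otimes> inv a \<in> U}"
      using assms open_subset_carrier[OF assms(1)] by (auto simp: m_assoc subset_iff)
  qed
  then show ?thesis
    using openin_right_preimage[OF assms(1)] assms(2) by simp
qed

lemma subgroup_closure_of:
  assumes S: "subgroup S G"
  shows "subgroup (T closure_of S) G"
proof -
  have SG: "S \<subseteq> carrier G"
    using S by (rule subgroup.subset)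
  show ?thesis
  proof (rule subgroupI)
    show "T closure_of S \<subseteq> carrier G"
      using closure_of_subset_topspace topspace_eq_carrier by metis
    show "T closure_of S \<noteq> {}"
      using closure_of_subset[of S T] SG subgroup.one_closed[OF S] topspace_eq_carrier by auto
    show "inv a \<in> T closure_of S" if "a \<in> T closure_of S" for a
    proof -
      have "(\<lambda>x. inv x) ` (T closure_of S) \<subseteq> T closure_of ((\<lambda>x. inv x) ` S)"
        by (rule continuous_map_image_closure_subset[OF continuous_inv])
      also have "\<dots> \<subseteq> T closure_of S"
        using subgroup.m_inv_closed[OF S] by (intro closure_of_mono) auto
      finally show ?thesis
        using that by blast
    qed
    show "a \<otimes> b \<in> T closure_of S" if "a \<in> T closure_of S" "b \<in> T closure_of S" for a b
    proof -
      have "(\<lambda>(x, y). x \<otimes> y) ` (prod_topology T T closure_of (S \<times> S))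
          \<subseteq> T closure_of ((\<lambda>(x, y). x \<otimes> y) ` (S \<times> S))"
        by (rule continuous_map_image_closure_subset[OF continuous_mult])
      also have "\<dots> \<subseteq> T closure_of S"
        using subgroup.m_closed[OF S] by (intro closure_of_mono) auto
      finally show ?thesis
        using that by (auto simp: closure_of_Times)
    qed
  qed
qed

lemma subgroup_topological_group:
  assumes H: "subgroup H G"
  shows "topological_group (G\<lparr>carrier := H\<rparr>) (subtopology T H)"
proof -
  have HG: "H \<subseteq> carrier G"
    using H by (rule subgroup.subset)
  have grp: "group (G\<lparr>carrier := H\<rparr>)"
    using H by (rule subgroup_imp_group)
  show ?thesis
  proof (intro topological_group.intro grp topological_group_axioms.intro)
    show "topspace (subtopology T H) = carrier (G\<lparr>carrier := H\<rparr>)"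
      using HG by (auto simp: topspace_eq_carrier)
    show "tychonoff_space (subtopology T H)"
      using tychonoff unfolding tychonoff_space_def
      by (simp add: completely_regular_space_subtopology Hausdorff_space_subtopology)
    have "continuous_map (subtopology (prod_topology T T) (H \<times> H)) (subtopology T H) (\<lambda>(x, y). x \<otimes> y)"
      using subgroup.m_closed[OF H]
      by (auto simp: continuous_map_in_subtopology intro: continuous_map_from_subtopology continuous_mult)
    then show "continuous_map (prod_topology (subtopology T H) (subtopology T H)) (subtopology T H)
        (\<lambda>(x, y). x \<otimes>\<^bsub>G\<lparr>carrier := H\<rparr>\<^esub> y)"
      by (simp add: subtopology_Times)
    have "continuous_map (subtopology T H) (subtopology T H) (\<lambda>x. inv x)"
      using subgroup.m_inv_closed[OF H]
      by (auto simp: continuous_map_in_subtopology intro: continuous_map_from_subtopology continuous_inv)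
    then show "continuous_map (subtopology T H) (subtopology T H) (\<lambda>x. inv\<^bsub>G\<lparr>carrier := H\<rparr>\<^esub> x)"
      by (rule continuous_map_eq) (use H in simp)
  qed
qed

lemma lcos_eq_iff:
  assumes K: "subgroup K G" and ab: "a \<in> carrier G" "b \<in> carrier G"
  shows "a <# K = b <# K \<longleftrightarrow> inv a \<otimes> b \<in> K"
proof
  assume "a <# K = b <# K"
  then have "b \<in> a <# K"
    using lcos_self[OF ab(2) K] by simp
  then show "inv a \<otimes> b \<in> K"
    by (rule subgroup.lcos_module_imp[OF K group_axioms ab(1)])
next
  assume "inv a \<otimes> b \<in> K"
  then have "b \<in> a <# K"
    by (rule subgroup.lcos_module_rev[OF K group_axioms ab])
  then show "a <# K = b <# K"
    by (rule l_repr_independence[OF _ ab(1) K])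
qed

text \<open>The saturation of an open set is a union of right translates of it.\<close>

lemma open_map_coset_topology:
  assumes K: "subgroup K G"
  shows "open_map T (coset_topology G T K) (\<lambda>x. x <# K)"
  unfolding open_map_def openin_coset_topology
proof (intro allI impI conjI)
  fix U assume U: "openin T U"
  have UG: "U \<subseteq> carrier G" and KG: "K \<subseteq> carrier G"
    using open_subset_carrier[OF U] subgroup.subset[OF K] .
  show "(\<lambda>x. x <# K) ` U \<subseteq> lcosets K"
    using UG by (auto simp: LCOSETS_def)
  have "{x \<in> topspace T. x <# K \<in> (\<lambda>x. x <# K) ` U} = (\<Union>k\<in>K. (\<lambda>x. x \<otimes> k) ` U)"
  proof (intro equalityI subsetI)
    fix x assume "x \<in> {x \<in> topspace T. x <# K \<in> (\<lambda>x. x <# K) ` U}"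
    then obtain u where u: "u \<in> U" "x \<in> carrier G" "u <# K = x <# K"
      by (auto simp: topspace_eq_carrier)
    then have "inv u \<otimes> x \<in> K" "x = u \<otimes> (inv u \<otimes> x)"
      using lcos_eq_iff[OF K] UG by (auto simp flip: m_assoc)
    then show "x \<in> (\<Union>k\<in>K. (\<lambda>x. x \<otimes> k) ` U)"
      using u(1) by blast
  next
    fix x assume "x \<in> (\<Union>k\<in>K. (\<lambda>x. x \<otimes> k) ` U)"
    then obtain u k where uk: "u \<in> U" "k \<in> K" "x = u \<otimes> k"
      by blast
    then have G: "u \<in> carrier G" "k \<in> carrier G" "x \<in> carrier G"
      using UG KG by auto
    then have "u <# K = x <# K"
      using uk by (subst lcos_eq_iff[OF K]) (auto simp flip: m_assoc)
    then show "x \<in> {x \<in> topspace T. x <# K \<in> (\<lambda>x. x <# K) ` U}"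
      using uk G by (auto simp: topspace_eq_carrier)
  qed
  also have "openin T \<dots>"
    using openin_right_translate[OF U] KG by blast
  finally show "openin T {x \<in> topspace T. x <# K \<in> (\<lambda>x. x <# K) ` U}" .
qed

end

section \<open>Weakly micro-transitive subgroups\<close>

text \<open>A map \<open>\<phi>\<close> with the last property below carries the action of \<open>G\<close> by left multiplication to an
  action on \<open>X\<close>, in which \<open>\<phi> (g \<otimes> x)\<close> is the translate of the point \<open>\<phi> x\<close> by \<open>g\<close>.  Points of \<open>X\<close> are
  represented by elements of \<open>G\<close> throughout, so that the action itself never has to be named.\<close>

locale equivariant_projection = topological_group G T
  for G :: "('a, 'm) monoid_scheme" (structure) and T :: "'a topology" +
  fixes X :: "'b topology" and \<phi> :: "'a \<Rightarrow> 'b"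
  assumes Hausdorff: "Hausdorff_space X"
    and continuous: "continuous_map T X \<phi>"
    and open_map: "open_map T X \<phi>"
    and surj: "\<phi> ` carrier G = topspace X"
    and equivariant: "\<lbrakk>g \<in> carrier G; a \<in> carrier G; b \<in> carrier G; \<phi> a = \<phi> b\<rbrakk> \<Longrightarrow> \<phi> (g \<otimes> a) = \<phi> (g \<otimes> b)"
begin

text \<open>For every neighbourhood \<open>V\<close> of \<open>\<one>\<close> there is a neighbourhood \<open>N\<close> such that \<open>N x\<close> lies in the
  closure of \<open>(H \<inter> V) x\<close>, and this for all points \<open>x\<close> of \<open>X\<close> simultaneously.  Density at the base
  point alone would not do: the back-and-forth construction visits points that are not known in advance.\<close>

definition weakly_microtransitive :: "'a set \<Rightarrow> bool"
  where "weakly_microtransitive H \<longleftrightarrow>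
    (\<forall>V. openin T V \<and> \<one> \<in> V \<longrightarrow>
      (\<exists>N. openin T N \<and> \<one> \<in> N \<and>
        (\<forall>g\<in>N. \<forall>x\<in>carrier G. \<forall>U. openin X U \<and> \<phi> (g \<otimes> x) \<in> U \<longrightarrow>
          (\<exists>h\<in>H \<inter> V. \<phi> (h \<otimes> x) \<in> U))))"

text \<open>The same without the closure: \<open>N x\<close> lies in \<open>(H \<inter> V) x\<close>.\<close>

definition microtransitive :: "'a set \<Rightarrow> bool"
  where "microtransitive H \<longleftrightarrow>
    (\<forall>V. openin T V \<and> \<one> \<in> V \<longrightarrow>
      (\<exists>N. openin T N \<and> \<one> \<in> N \<and>
        (\<forall>g\<in>N. \<forall>x\<in>carrier G. \<exists>h\<in>H \<inter> V. \<phi> (h \<otimes> x) = \<phi> (g \<otimes> x))))"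

text \<open>Let \<open>z\<^sub>k\<close> be \<open>x\<close> for even and \<open>y\<close> for odd \<open>k\<close>.  The proof builds \<open>c\<^sub>0 = c\<^sub>1 = \<one>\<close> and
  \<open>c\<^sub>k\<^sub>+\<^sub>2 = h c\<^sub>k\<close> with \<open>h \<in> H\<close>, so that the even terms act on \<open>x\<close> and the odd terms on \<open>y\<close>.  The
  invariant is that the point \<open>c\<^sub>k\<^sub>+\<^sub>1 z\<^sub>k\<^sub>+\<^sub>1\<close> lies in \<open>N\<^sub>k c\<^sub>k z\<^sub>k\<close>, where \<open>N\<^sub>k\<close> is small relative to \<open>c\<^sub>k\<close>:
  the elements of \<open>N\<^sub>k c\<^sub>k\<close> are within \<open>e/2\<^sup>k\<close> of \<open>c\<^sub>k\<close>.  Weak micro-transitivity moves \<open>c\<^sub>k z\<^sub>k\<close> into the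
  open set \<open>N\<^sub>k\<^sub>+\<^sub>1 c\<^sub>k\<^sub>+\<^sub>1 z\<^sub>k\<^sub>+\<^sub>1\<close>, which is the invariant for \<open>k + 1\<close> with the two roles exchanged.\<close>

lemma weakly_microtransitive_imp_microtransitive:
  assumes complete: "completely_metrizable_space T"
    and H: "subgroup H G" "closedin T H"
    and weak: "weakly_microtransitive H"
  shows "microtransitive H"
  unfolding microtransitive_def
proof (intro allI impI)
  fix W assume "openin T W \<and> \<one> \<in> W"
  then have W: "openin T W" "\<one> \<in> W"
    by auto
  obtain M d where "Metric_space M d" and dcomplete: "Metric_space.mcomplete M d"
    and T: "T = Metric_space.mtopology M d"
    using complete by (auto simp: completely_metrizable_space_def)
  then interpret Metric_space M d by simp
  have M: "x \<in> M \<longleftrightarrow> x \<in> carrier G" for x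
    using topspace_eq_carrier by (simp add: T)
  have HG: "H \<subseteq> carrier G"
    using H(1) by (rule subgroup.subset)
  obtain e where e: "e > 0"
    and eW: "\<And>p s. p \<in> carrier G \<Longrightarrow> s \<in> carrier G \<Longrightarrow> d \<one> p \<le> 2 * e \<Longrightarrow> d \<one> s \<le> 2 * e \<Longrightarrow> inv s \<otimes> p \<in> W"
  proof -
    have "continuous_map (prod_topology T T) T (\<lambda>q. inv (snd q) \<otimes> fst q)"
      by (intro continuous_map_group_mult continuous_map_group_inv continuous_map_fst continuous_map_snd)
    from openin_continuous_map_preimage[OF this W(1)]
    have "openin (prod_topology T T) {q \<in> carrier G \<times> carrier G. inv (snd q) \<otimes> fst q \<in> W}"
      by (simp add: topspace_eq_carrier)
    moreover have "(\<one>, \<one>) \<in> {q \<in> carrier G \<times> carrier G. inv (snd q) \<otimes> fst q \<in> W}"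
      using W by auto
    ultimately obtain A B where AB: "openin T A" "openin T B" "\<one> \<in> A" "\<one> \<in> B"
      and sub: "A \<times> B \<subseteq> {q \<in> carrier G \<times> carrier G. inv (snd q) \<otimes> fst q \<in> W}"
      unfolding openin_prod_topology_alt by meson
    have "openin T (A \<inter> B)" "\<one> \<in> A \<inter> B"
      using AB by auto
    then obtain r where r: "r > 0" "mball \<one> r \<subseteq> A \<inter> B"
      unfolding T openin_mtopology by blast
    show ?thesis
    proof (rule that[of "r / 3"])
      fix p s assume "p \<in> carrier G" "s \<in> carrier G" "d \<one> p \<le> 2 * (r / 3)" "d \<one> s \<le> 2 * (r / 3)"
      then have "p \<in> mball \<one> r" "s \<in> mball \<one> r"
        using r(1) M by auto
      then have "(p, s) \<in> A \<times> B"
        using r(2) by blast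
      then show "inv s \<otimes> p \<in> W"
        using sub by auto
    qed (use r in simp)
  qed
  (* Weak micro-transitivity is applied to near c k, so multiplying c on the left by the element obtained
     changes it by less than e / 2 ^ k. *)
  define near where "near c k = {g \<in> carrier G. g \<otimes> c \<in> mball c (e / 2 ^ k)}" for c and k :: nat
  have "\<exists>N. openin T N \<and> \<one> \<in> N \<and> N \<subseteq> near c k \<and>
      (\<forall>g\<in>N. \<forall>x\<in>carrier G. \<forall>U. openin X U \<and> \<phi> (g \<otimes> x) \<in> U \<longrightarrow>
          (\<exists>h\<in>H \<inter> near c k. \<phi> (h \<otimes> x) \<in> U))" if c: "c \<in> carrier G" for c k
  proof -
    have near: "openin T (near c k)" "\<one> \<in> near c k"
      using openin_right_preimage[OF _ c, of "mball c (e / 2 ^ k)"] c e M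
      by (auto simp: near_def T)
    with weak obtain N where N: "openin T N" "\<one> \<in> N"
      "\<forall>g\<in>N. \<forall>x\<in>carrier G. \<forall>U. openin X U \<and> \<phi> (g \<otimes> x) \<in> U \<longrightarrow>
          (\<exists>h\<in>H \<inter> near c k. \<phi> (h \<otimes> x) \<in> U)"
      unfolding weakly_microtransitive_def by meson
    then show ?thesis
      using near by (intro exI[of _ "N \<inter> near c k"]) auto
  qed
  then obtain N where N: "\<And>c k. c \<in> carrier G \<Longrightarrow> openin T (N c k)"
      "\<And>c k. c \<in> carrier G \<Longrightarrow> \<one> \<in> N c k" "\<And>c k. c \<in> carrier G \<Longrightarrow> N c k \<subseteq> near c k"
    and Nh: "\<And>c k g x U. \<lbrakk>c \<in> carrier G; g \<in> N c k; x \<in> carrier G; openin X U; \<phi> (g \<otimes> x) \<in> U\<rbrakk> \<Longrightarrow>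
          \<exists>h\<in>H \<inter> near c k. \<phi> (h \<otimes> x) \<in> U"
    by metis
  show "\<exists>V. openin T V \<and> \<one> \<in> V \<and>
        (\<forall>g\<in>V. \<forall>x\<in>carrier G. \<exists>h\<in>H \<inter> W. \<phi> (h \<otimes> x) = \<phi> (g \<otimes> x))"
  proof (intro exI[of _ "N \<one> 0"] conjI ballI)
    show "openin T (N \<one> 0)" "\<one> \<in> N \<one> 0"
      using N by auto
    fix g x assume g: "g \<in> N \<one> 0" and x: "x \<in> carrier G"
    then have gG: "g \<in> carrier G"
      using N(3)[of \<one> 0] by (auto simp: near_def)
    define y where "y = g \<otimes> x"
    have y: "y \<in> carrier G"
      using gG x by (simp add: y_def)
    define z where "z k = (if even k then x else y)" for k :: nat
    have z: "z k \<in> carrier G" for k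
      using x y by (simp add: z_def)
    (* A state is the pair (c n, c (Suc n)).  P is the invariant, pinned at stage 0 to the start (1, 1),
       and Q links consecutive states. *)
    define P where "P n p \<longleftrightarrow> fst p \<in> H \<and> snd p \<in> H \<and>
        (\<exists>v\<in>N (fst p) n. \<phi> (snd p \<otimes> z (Suc n)) = \<phi> (v \<otimes> fst p \<otimes> z n)) \<and>
        (n = 0 \<longrightarrow> p = (\<one>, \<one>))" for n p
    define Q where "Q n p q \<longleftrightarrow> fst q = snd p \<and> d (fst p) (snd q) < e / 2 ^ n" for n :: nat and p q :: "'a \<times> 'a"
    have "\<exists>p. P 0 p"
    proof
      show "P 0 (\<one>, \<one>)"
        using g gG x y subgroup.one_closed[OF H(1)] by (auto simp: P_def z_def y_def intro!: bexI[of _ g])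
    qed
    moreover have "\<exists>q. P (Suc n) q \<and> Q n p q" if "P n p" for n p
    proof -
      obtain a b where p: "p = (a, b)"
        by fastforce
      from that obtain v where ab: "a \<in> H" "b \<in> H" and v: "v \<in> N a n"
        and eq: "\<phi> (b \<otimes> z (Suc n)) = \<phi> (v \<otimes> (a \<otimes> z n))"
        using N(3) HG z[of n] unfolding P_def p near_def by (fastforce simp: m_assoc)
      have G: "a \<in> carrier G" "b \<in> carrier G"
        using ab HG by auto
      let ?U = "\<phi> ` (\<lambda>w. w \<otimes> (b \<otimes> z (Suc n))) ` N b (Suc n)"
      have "openin X ?U"
        using open_map openin_right_translate[OF N(1)] G z unfolding open_map_def by auto
      moreover have "\<phi> (b \<otimes> z (Suc n)) \<in> ?U"
        using N(2)[OF G(2), of "Suc n"] G z[of "Suc n"]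
        by (intro imageI image_eqI[of _ _ \<one>]) auto
      ultimately obtain h where h: "h \<in> H" "h \<in> near a n" and hU: "\<phi> (h \<otimes> (a \<otimes> z n)) \<in> ?U"
        using Nh[OF G(1) v, of "a \<otimes> z n" ?U] eq G z[of n] by auto
      obtain w where w: "w \<in> N b (Suc n)" "\<phi> (h \<otimes> (a \<otimes> z n)) = \<phi> (w \<otimes> (b \<otimes> z (Suc n)))"
        using hU by auto
      have wG: "w \<in> carrier G" "h \<in> carrier G"
        using N(3)[OF G(2)] w h by (auto simp: near_def)
      have "P (Suc n) (b, h \<otimes> a)"
        unfolding P_def
        using ab h(1) w wG G z[of n] z[of "Suc n"] subgroup.m_closed[OF H(1)]
        by (auto simp: m_assoc z_def intro!: bexI[of _ w])
      moreover have "Q n p (b, h \<otimes> a)"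
        using h(2) by (auto simp: Q_def p near_def)
      ultimately show ?thesis
        by blast
    qed
    ultimately obtain f where f: "\<And>n. P n (f n)" "\<And>n. Q n (f n) (f (Suc n))"
      using dependent_nat_choice[of P Q] by blast
    define c where "c n = fst (f n)" for n
    have snd_f: "snd (f n) = c (Suc n)" for n
      using f(2)[of n] by (simp add: Q_def c_def)
    have cH: "c n \<in> H" for n
      using f(1)[of n] by (simp add: P_def c_def)
    then have cG: "c n \<in> carrier G" for n
      using HG by blast
    have c01: "c 0 = \<one>" "c (Suc 0) = \<one>"
      using f(1)[of 0] snd_f[of 0] by (auto simp: P_def c_def)
    have step: "d (c n) (c (Suc (Suc n))) < e / 2 ^ n" for n
      using f(2)[of n] snd_f[of "Suc n"] by (simp add: Q_def c_def)
    (* The element u n = v c n witnessing the invariant has the same limit as c along even n. *)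
    have "\<exists>u. u \<in> carrier G \<and> d (c n) u < e / 2 ^ n \<and> \<phi> (c (Suc n) \<otimes> z (Suc n)) = \<phi> (u \<otimes> z n)" for n
    proof -
      obtain v where v: "v \<in> N (c n) n" "\<phi> (c (Suc n) \<otimes> z (Suc n)) = \<phi> (v \<otimes> c n \<otimes> z n)"
        using f(1)[of n] snd_f[of n] by (auto simp: P_def c_def)
      then show ?thesis
        using N(3)[OF cG, of n n] M by (intro exI[of _ "v \<otimes> c n"]) (auto simp: near_def)
    qed
    then obtain u where u: "\<And>n. u n \<in> carrier G" "\<And>n. d (c n) (u n) < e / 2 ^ n"
      "\<And>n. \<phi> (c (Suc n) \<otimes> z (Suc n)) = \<phi> (u n \<otimes> z n)"
      by metis
    have pow: "e / 2 ^ (2 * n) \<le> e / 2 ^ n" "e / 2 ^ Suc (2 * n) \<le> e / 2 ^ n" for n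
      using e by (intro divide_left_mono power_increasing mult_pos_pos; simp)+
    obtain p where p: "limitin mtopology (\<lambda>n. c (2 * n)) p sequentially" "d \<one> p \<le> 2 * e"
    proof (rule mcomplete_geometric_limit[OF dcomplete, of "\<lambda>n. c (2 * n)" e])
      show "d (c (2 * n)) (c (2 * Suc n)) \<le> e / 2 ^ n" for n
        using step[of "2 * n"] pow(1)[of n] by simp
    qed (use cG M c01 that in auto)
    obtain s where s: "limitin mtopology (\<lambda>n. c (Suc (2 * n))) s sequentially" "d \<one> s \<le> 2 * e"
    proof (rule mcomplete_geometric_limit[OF dcomplete, of "\<lambda>n. c (Suc (2 * n))" e])
      show "d (c (Suc (2 * n))) (c (Suc (2 * Suc n))) \<le> e / 2 ^ n" for n
        using step[of "Suc (2 * n)"] pow(2)[of n] by simp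
    qed (use cG M c01 that in auto)
    have psH: "p \<in> H" "s \<in> H"
      using H(2) cH by (auto intro: limitin_closedin[OF p(1)] limitin_closedin[OF s(1)] simp: T)
    then have psG: "p \<in> carrier G" "s \<in> carrier G"
      using HG by auto
    have "limitin mtopology (\<lambda>n. u (2 * n)) p sequentially"
      unfolding limitin_metric_dist_null
    proof (intro conjI)
      have lim: "(\<lambda>n. d (c (2 * n)) p) \<longlonglongrightarrow> 0"
        using p(1) by (simp add: limitin_metric_dist_null)
      have "(\<lambda>n. e / 2 ^ n) \<longlonglongrightarrow> 0"
        by (rule LIMSEQ_divide_realpow_zero) simp
      from tendsto_add[OF this lim] have upper: "(\<lambda>n. e / 2 ^ n + d (c (2 * n)) p) \<longlonglongrightarrow> 0"
        by simp
      show "(\<lambda>n. d (u (2 * n)) p) \<longlonglongrightarrow> 0"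
      proof (rule tendsto_sandwich[OF _ _ tendsto_const upper])
        have "d (u (2 * n)) p \<le> e / 2 ^ n + d (c (2 * n)) p" for n
          using triangle[of "u (2 * n)" "c (2 * n)" p] u(1)[of "2 * n"] u(2)[of "2 * n"] cG[of "2 * n"] psG
            commute[of "u (2 * n)" "c (2 * n)"] pow(1)[of n] M by auto
        then show "\<forall>\<^sub>F n in sequentially. d (u (2 * n)) p \<le> e / 2 ^ n + d (c (2 * n)) p"
          by simp
      qed simp
    qed (use u M psG in auto)
    then have lim_u: "limitin T (\<lambda>n. u (2 * n)) p sequentially"
      by (simp add: T)
    have cont: "continuous_map T X (\<lambda>g. \<phi> (g \<otimes> a))" if "a \<in> carrier G" for a
      using continuous_map_compose[OF continuous_map_right_translate[OF that] continuous]
      by (simp add: o_def)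
    have "limitin X (\<lambda>n. \<phi> (u (2 * n) \<otimes> x)) (\<phi> (p \<otimes> x)) sequentially"
      using continuous_map_limit[OF cont[OF x] lim_u] by (simp add: o_def)
    moreover have "limitin X (\<lambda>n. \<phi> (c (Suc (2 * n)) \<otimes> y)) (\<phi> (s \<otimes> y)) sequentially"
      using continuous_map_limit[OF cont[OF y], of _ s sequentially] s(1) by (simp add: o_def T)
    moreover have "\<phi> (c (Suc (2 * n)) \<otimes> y) = \<phi> (u (2 * n) \<otimes> x)" for n
      using u(3)[of "2 * n"] by (simp add: z_def)
    ultimately have "\<phi> (p \<otimes> x) = \<phi> (s \<otimes> y)"
      using limitin_Hausdorff_unique[OF _ _ trivial_limit_sequentially Hausdorff] by auto
    then have "\<phi> (inv s \<otimes> (p \<otimes> x)) = \<phi> (inv s \<otimes> (s \<otimes> y))"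
      using psG x y by (intro equivariant) auto
    moreover have "inv s \<otimes> (s \<otimes> y) = y"
      using psG y by (simp flip: m_assoc)
    ultimately have "\<phi> (inv s \<otimes> p \<otimes> x) = \<phi> (g \<otimes> x)"
      using psG x by (simp add: m_assoc y_def)
    moreover have "inv s \<otimes> p \<in> H \<inter> W"
      using eW[OF psG p(2) s(2)] psH subgroup.m_closed[OF H(1)] subgroup.m_inv_closed[OF H(1)] by auto
    ultimately show "\<exists>h\<in>H \<inter> W. \<phi> (h \<otimes> x) = \<phi> (g \<otimes> x)"
      by blast
  qed
qed

text \<open>Micro-transitivity makes all orbits of \<open>H\<close> open.  A dense orbit therefore meets every other orbit,
  so there is only one, and \<open>\<phi>\<close> maps \<open>H\<close> onto \<open>X\<close>.\<close>

lemma microtransitive_imp_quotient_map: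
  assumes H: "subgroup H G" and micro: "microtransitive H"
    and dense: "\<And>U. openin X U \<Longrightarrow> U \<noteq> {} \<Longrightarrow> \<exists>h\<in>H. \<phi> h \<in> U"
  shows "quotient_map (subtopology T H) X \<phi>"
proof (rule continuous_open_imp_quotient_map)
  have HG: "H \<subseteq> carrier G"
    using H by (rule subgroup.subset)
  then have topH: "topspace (subtopology T H) = H"
    by (auto simp: topspace_eq_carrier)
  show "continuous_map (subtopology T H) X \<phi>"
    using continuous by (rule continuous_map_from_subtopology)
  show "open_map (subtopology T H) X \<phi>"
    unfolding open_map_def
  proof (intro allI impI)
    fix U assume "openin (subtopology T H) U"
    then obtain W where W: "openin T W" "U = W \<inter> H"
      by (auto simp: openin_subtopology)
    show "openin X (\<phi> ` U)"
    proof (subst openin_subopen, intro ballI)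
      fix t assume "t \<in> \<phi> ` U"
      then obtain h where h: "h \<in> W" "h \<in> H" "t = \<phi> h"
        using W by auto
      then have hG: "h \<in> carrier G"
        using HG by auto
      have "openin T {x \<in> carrier G. h \<otimes> x \<in> W}" "\<one> \<in> {x \<in> carrier G. h \<otimes> x \<in> W}"
        using openin_left_preimage[OF W(1) hG] h hG by auto
      then obtain N where N: "openin T N" "\<one> \<in> N"
        and Nh: "\<forall>g\<in>N. \<forall>x\<in>carrier G. \<exists>k\<in>H \<inter> {x \<in> carrier G. h \<otimes> x \<in> W}. \<phi> (k \<otimes> x) = \<phi> (g \<otimes> x)"
        using micro unfolding microtransitive_def by meson
      let ?V = "\<phi> ` (\<lambda>g. h \<otimes> g) ` N"
      have "openin X ?V"
        using open_map openin_left_translate[OF N(1) hG] by (simp add: open_map_def)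
      moreover have "t \<in> ?V"
        using N(2) h(3) hG by (metis image_eqI r_one)
      moreover have "?V \<subseteq> \<phi> ` U"
      proof (clarify)
        fix g assume g: "g \<in> N"
        then have gG: "g \<in> carrier G"
          using open_subset_carrier[OF N(1)] by blast
        obtain k where k: "k \<in> H" "h \<otimes> k \<in> W" "\<phi> k = \<phi> g"
          using bspec[OF bspec[OF Nh g] one_closed] gG HG by (auto simp: subset_iff)
        then have "\<phi> (h \<otimes> g) = \<phi> (h \<otimes> k)"
          using hG gG HG by (intro equivariant) auto
        then show "\<phi> (h \<otimes> g) \<in> \<phi> ` U"
          using k h subgroup.m_closed[OF H] W(2) by auto
      qed
      ultimately show "\<exists>V. openin X V \<and> t \<in> V \<and> V \<subseteq> \<phi> ` U"
        by blast
    qed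
  qed
  show "\<phi> ` topspace (subtopology T H) = topspace X"
    unfolding topH
  proof
    show "\<phi> ` H \<subseteq> topspace X"
      using surj HG by auto
    show "topspace X \<subseteq> \<phi> ` H"
    proof
      fix t assume "t \<in> topspace X"
      then obtain y where y: "y \<in> carrier G" "t = \<phi> y"
        using surj by auto
      obtain N where N: "openin T N" "\<one> \<in> N"
        and Nh: "\<forall>g\<in>N. \<forall>x\<in>carrier G. \<exists>k\<in>H \<inter> carrier G. \<phi> (k \<otimes> x) = \<phi> (g \<otimes> x)"
        using micro openin_topspace[of T] one_closed topspace_eq_carrier
        unfolding microtransitive_def by metis
      let ?U = "\<phi> ` (\<lambda>g. g \<otimes> y) ` N"
      have "openin X ?U"
        using open_map openin_right_translate[OF N(1) y(1)] by (simp add: open_map_def)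
      then obtain h where h: "h \<in> H" "\<phi> h \<in> ?U"
        using dense[of ?U] N(2) by blast
      then obtain g where g: "g \<in> N" "\<phi> h = \<phi> (g \<otimes> y)"
        by auto
      then obtain k where k: "k \<in> H" "\<phi> (k \<otimes> y) = \<phi> h"
        using Nh y by force
      have G: "h \<in> carrier G" "k \<in> carrier G"
        using h k HG by auto
      have "\<phi> (inv k \<otimes> (k \<otimes> y)) = \<phi> (inv k \<otimes> h)"
        using G y k by (intro equivariant) auto
      then have "\<phi> y = \<phi> (inv k \<otimes> h)"
        using G y by (simp flip: m_assoc)
      then show "t \<in> \<phi> ` H"
        using y(2) h k subgroup.m_closed[OF H] subgroup.m_inv_closed[OF H] by blast
    qed
  qed
qed

text \<open>If \<open>g x\<close> lies in a basic open set \<open>A'\<close>, continuity gives a basic open set \<open>A\<close> around \<open>x\<close> that \<open>g\<close> maps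
  into \<open>A'\<close>.  Any other element of \<open>V n\<close> that maps \<open>A\<close> into \<open>A'\<close> also moves \<open>x\<close> into \<open>A'\<close>, so one choice for
  each triple \<open>(n, A, A')\<close> serves all points and all elements of \<open>V n\<close>.\<close>

lemma small_pointwise_dense_family:
  assumes B: "topology_base X \<B>" and V: "\<And>n :: nat. V n \<subseteq> carrier G"
  shows "\<exists>D\<subseteq>carrier G. |D| \<le>o |(UNIV :: nat set) \<times> \<B> \<times> \<B>| \<and>
    (\<forall>n. \<forall>g\<in>V n. \<forall>x\<in>carrier G. \<forall>U. openin X U \<and> \<phi> (g \<otimes> x) \<in> U \<longrightarrow>
      (\<exists>h\<in>D \<inter> V n. \<phi> (h \<otimes> x) \<in> U))"
proof -
  have Bopen: "\<And>A. A \<in> \<B> \<Longrightarrow> openin X A"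
    and Bin: "\<And>U t. openin X U \<Longrightarrow> t \<in> U \<Longrightarrow> \<exists>A\<in>\<B>. t \<in> A \<and> A \<subseteq> U"
    using B unfolding topology_base_def openin_topology_base_unique by metis+
  define R where "R n A A' g \<longleftrightarrow> g \<in> V n \<and> (\<forall>x\<in>carrier G. \<phi> x \<in> A \<longrightarrow> \<phi> (g \<otimes> x) \<in> A')" for n A A' g
  define c where "c = (\<lambda>(n, A, A'). if \<exists>g. R n A A' g then SOME g. R n A A' g else \<one>)"
  have c: "R n A A' (c (n, A, A'))" if "R n A A' g" for n A A' g
    using that by (auto simp: c_def intro: someI)
  let ?D = "c ` (UNIV \<times> \<B> \<times> \<B>)"
  have "c (n, A, A') \<in> carrier G" for n A A'
  proof (cases "\<exists>g. R n A A' g")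
    case True
    then have "R n A A' (c (n, A, A'))"
      using c by blast
    then show ?thesis
      using V by (auto simp: R_def)
  qed (auto simp: c_def)
  then have "?D \<subseteq> carrier G"
    by blast
  moreover have "|?D| \<le>o |(UNIV :: nat set) \<times> \<B> \<times> \<B>|"
    by (rule card_of_image)
  moreover have "\<exists>h\<in>?D \<inter> V n. \<phi> (h \<otimes> x) \<in> U"
    if g: "g \<in> V n" and x: "x \<in> carrier G" and U: "openin X U" "\<phi> (g \<otimes> x) \<in> U" for n g x U
  proof -
    have gG: "g \<in> carrier G"
      using g V by blast
    obtain A' where A': "A' \<in> \<B>" "\<phi> (g \<otimes> x) \<in> A'" "A' \<subseteq> U"
      using Bin[OF U] by blast
    let ?O = "{y \<in> carrier G. g \<otimes> y \<in> {w \<in> carrier G. \<phi> w \<in> A'}}"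
    have "openin T {w \<in> carrier G. \<phi> w \<in> A'}"
      using openin_continuous_map_preimage[OF continuous Bopen[OF A'(1)]] by (simp add: topspace_eq_carrier)
    then have "openin X (\<phi> ` ?O)"
      using openin_left_preimage[OF _ gG] open_map unfolding open_map_def by blast
    moreover have "\<phi> x \<in> \<phi> ` ?O"
      using x gG A' by auto
    ultimately obtain A where A: "A \<in> \<B>" "\<phi> x \<in> A" "A \<subseteq> \<phi> ` ?O"
      using Bin by meson
    have "\<phi> (g \<otimes> y) \<in> A'" if y: "y \<in> carrier G" "\<phi> y \<in> A" for y
    proof -
      obtain y' where y': "y' \<in> carrier G" "\<phi> (g \<otimes> y') \<in> A'" "\<phi> y = \<phi> y'"
        using A(3) y(2) by auto
      then show ?thesis
        using equivariant[OF gG y(1) y'(1,3)] by simp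
    qed
    then have "R n A A' g"
      using g by (auto simp: R_def)
    then have "R n A A' (c (n, A, A'))"
      by (rule c)
    then have "c (n, A, A') \<in> V n" "\<phi> (c (n, A, A') \<otimes> x) \<in> U"
      using x A(2) A'(3) by (auto simp: R_def)
    then show ?thesis
      using A(1) A'(1) by (intro bexI[of _ "c (n, A, A')"]) auto
  qed
  ultimately show ?thesis
    by (intro exI[of _ ?D]) blast
qed

lemma exists_small_quotient_subgroup:
  assumes complete: "completely_metrizable_space T" and B: "topology_base X \<B>"
  shows "\<exists>H. subgroup H G \<and> closedin T H \<and> quotient_map (subtopology T H) X \<phi> \<and>
    weight (subtopology T H) \<le>o |(UNIV :: nat set) <+> \<B>|"
proof -
  have metr: "metrizable_space T"
    using complete by (rule completely_metrizable_imp_metrizable_space)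
  then obtain M d where "Metric_space M d" and T: "T = Metric_space.mtopology M d"
    by (auto simp: metrizable_space_def)
  then interpret Metric_space M d by simp
  have M: "x \<in> M \<longleftrightarrow> x \<in> carrier G" for x
    using topspace_eq_carrier by (simp add: T)
  (* V 0 is all of G, which makes the orbit of the base point dense; the other V n form a neighbourhood
     base of the identity. *)
  define V where "V n = (case n of 0 \<Rightarrow> carrier G | Suc k \<Rightarrow> mball \<one> (inverse (Suc k)))" for n :: nat
  have VG: "V n \<subseteq> carrier G" for n
  proof (cases n)
    case (Suc k)
    show ?thesis
      unfolding V_def Suc nat.case using mball_subset_mspace M by blast
  qed (simp add: V_def)
  from small_pointwise_dense_family[OF B, of V, OF VG]
  obtain D where DG: "D \<subseteq> carrier G" and cardD: "|D| \<le>o |(UNIV :: nat set) \<times> \<B> \<times> \<B>|"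
    and dense: "\<forall>n. \<forall>g\<in>V n. \<forall>x\<in>carrier G. \<forall>U. openin X U \<and> \<phi> (g \<otimes> x) \<in> U \<longrightarrow>
      (\<exists>h\<in>D \<inter> V n. \<phi> (h \<otimes> x) \<in> U)"
    by blast
  have D: "\<exists>h\<in>D \<inter> V n. \<phi> (h \<otimes> x) \<in> U"
    if "g \<in> V n" "x \<in> carrier G" "openin X U" "\<phi> (g \<otimes> x) \<in> U" for n g x U
    using dense that by blast
  (* The summand nat keeps the cardinal bound infinite when X, and with it the base, is finite. *)
  let ?A = "(UNIV :: nat set) <+> \<B>"
  have inf: "infinite ?A"
    by (simp add: finite_Plus_iff)
  have natA: "|UNIV :: nat set| \<le>o |?A|" and BA: "|\<B>| \<le>o |?A|"
    by (rule card_of_Plus1, rule card_of_Plus2)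
  have times: "|P \<times> Q| \<le>o |?A|" if "|P| \<le>o |?A|" "|Q| \<le>o |?A|" for P :: "'p set" and Q :: "'q set"
    using that inf by (intro card_of_Times_ordLeq_infinite_Field) (auto simp: Field_card_of intro: card_of_card_order_on)
  have "|D| \<le>o |?A|"
    using cardD times[OF natA times[OF BA BA]] by (rule ordLeq_transitive)
  then obtain S where S: "subgroup S G" "D \<subseteq> S" "|S| \<le>o |?A|"
    using card_generated_subgroup[OF group_axioms inf DG] by blast
  let ?H = "T closure_of S"
  have H: "subgroup ?H G" "closedin T ?H"
    using subgroup_closure_of[OF S(1)] by auto
  have SG: "S \<subseteq> carrier G"
    using S(1) by (rule subgroup.subset)
  have SH: "S \<subseteq> ?H"
    using SG by (intro closure_of_subset) (simp add: topspace_eq_carrier)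
  have "weakly_microtransitive ?H"
    unfolding weakly_microtransitive_def
  proof (intro allI impI)
    fix U assume "openin T U \<and> \<one> \<in> U"
    then obtain r where r: "r > 0" "mball \<one> r \<subseteq> U"
      unfolding T openin_mtopology by blast
    obtain n where n: "inverse (real (Suc n)) < r"
      using r reals_Archimedean by auto
    have VU: "V (Suc n) \<subseteq> U"
      using r n by (auto simp: V_def)
    have "openin T (V (Suc n))" "\<one> \<in> V (Suc n)"
      using M by (auto simp: V_def T)
    moreover have "\<exists>h\<in>?H \<inter> U. \<phi> (h \<otimes> x) \<in> E"
      if gx: "g \<in> V (Suc n)" "x \<in> carrier G" and E: "openin X E \<and> \<phi> (g \<otimes> x) \<in> E" for g x E
      using D[OF gx] E VU S(2) SH by blast
    ultimately show "\<exists>N. openin T N \<and> \<one> \<in> N \<and> (\<forall>g\<in>N. \<forall>x\<in>carrier G.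
        \<forall>E. openin X E \<and> \<phi> (g \<otimes> x) \<in> E \<longrightarrow> (\<exists>h\<in>?H \<inter> U. \<phi> (h \<otimes> x) \<in> E))"
      by (intro exI[of _ "V (Suc n)"]) blast
  qed
  then have "microtransitive ?H"
    by (rule weakly_microtransitive_imp_microtransitive[OF complete H])
  moreover have "\<exists>h\<in>?H. \<phi> h \<in> U" if U: "openin X U" "U \<noteq> {}" for U
  proof -
    have "U \<subseteq> \<phi> ` carrier G"
      using openin_subset[OF U(1)] surj by simp
    then obtain g where g: "g \<in> carrier G" "\<phi> g \<in> U"
      using U(2) by blast
    then obtain h where "h \<in> D" "\<phi> (h \<otimes> \<one>) \<in> U"
      using D[of g 0 \<one> U] U(1) g by (auto simp: V_def)
    then show ?thesis
      using DG S(2) SH by (metis r_one subsetD)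
  qed
  ultimately have quot: "quotient_map (subtopology T ?H) X \<phi>"
    by (rule microtransitive_imp_quotient_map[OF H(1)])
  have "subtopology T ?H closure_of S = topspace (subtopology T ?H)"
    using SH closure_of_subset_topspace[of T S] by (auto simp: closure_of_subtopology Int_absorb1)
  then have "weight (subtopology T ?H) \<le>o |(UNIV :: nat set) \<times> S|"
    using metrizable_space_subtopology[OF metr] SH SG
    by (intro weight_le_dense_subset) (auto simp: topspace_eq_carrier)
  then have "weight (subtopology T ?H) \<le>o |?A|"
    using times[OF natA S(3)] by (rule ordLeq_transitive)
  then show ?thesis
    using H quot by blast
qed

end

section \<open>Coset spaces\<close>

theorem theorem5p10:
  fixes G :: "('a, 'm) monoid_scheme" and T :: "'a topology" and X :: "'b topology"
  assumes "topological_group G T"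
    and "completely_metrizable_space T"
    and "tychonoff_space X"
    and "coset_space_of X G T"
  shows "\<exists>H. subgroup H G \<and>
    completely_metrizable_space (subtopology T H) \<and>
    coset_space_of X (G\<lparr>carrier := H\<rparr>) (subtopology T H) \<and>
    (infinite (topspace X) \<longrightarrow> weight (subtopology T H) \<le>o weight X) \<and>
    (finite (topspace X) \<longrightarrow> weight (subtopology T H) \<le>o natLeq)"
proof -
  interpret topological_group G T by fact
  have Haus: "Hausdorff_space X"
    using assms(3) by (simp add: tychonoff_space_def)
  obtain K where K: "subgroup K G" "closedin T K"
    and "X homeomorphic_space coset_topology G T K"
    using assms(4) unfolding coset_space_of_def by blast
  then obtain f where f: "homeomorphic_map (coset_topology G T K) X f"
    using homeomorphic_space homeomorphic_space_sym by blast
  define \<phi> where "\<phi> x = f (x <#\<^bsub>G\<^esub> K)" for x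
  have \<phi>: "\<phi> = f \<circ> (\<lambda>x. x <#\<^bsub>G\<^esub> K)"
    by (auto simp: \<phi>_def)
  have fibre: "\<phi> a = \<phi> b \<longleftrightarrow> inv\<^bsub>G\<^esub> a \<otimes>\<^bsub>G\<^esub> b \<in> K" if ab: "a \<in> carrier G" "b \<in> carrier G" for a b
  proof -
    have "inj_on f (lcosets\<^bsub>G\<^esub> K)"
      using f unfolding homeomorphic_map_def topspace_coset_topology by blast
    moreover have "a <#\<^bsub>G\<^esub> K \<in> lcosets\<^bsub>G\<^esub> K" "b <#\<^bsub>G\<^esub> K \<in> lcosets\<^bsub>G\<^esub> K"
      using ab by (auto simp: LCOSETS_def)
    ultimately show ?thesis
      using lcos_eq_iff[OF K(1) ab] by (simp add: \<phi>_def inj_on_eq_iff)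
  qed
  have quot: "quotient_map T X \<phi>"
    unfolding \<phi> using quotient_map_coset_topology conjunct1[OF f[unfolded homeomorphic_map_def]]
    by (rule quotient_map_compose)
  interpret equivariant_projection G T X \<phi>
  proof
    show "continuous_map T X \<phi>"
      using quot by (rule quotient_imp_continuous_map)
    show "open_map T X \<phi>"
      unfolding \<phi> using open_map_coset_topology[OF K(1)] homeomorphic_imp_open_map[OF f]
      by (rule open_map_compose)
    show "\<phi> ` carrier G = topspace X"
      using quotient_imp_surjective_map[OF quot] by (simp add: topspace_eq_carrier)
    show "\<phi> (g \<otimes>\<^bsub>G\<^esub> a) = \<phi> (g \<otimes>\<^bsub>G\<^esub> b)"
      if "g \<in> carrier G" "a \<in> carrier G" "b \<in> carrier G" "\<phi> a = \<phi> b" for g a b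
    proof -
      have "inv\<^bsub>G\<^esub> g \<otimes>\<^bsub>G\<^esub> (g \<otimes>\<^bsub>G\<^esub> b) = b"
        using that by (simp flip: m_assoc)
      then have "inv\<^bsub>G\<^esub> (g \<otimes>\<^bsub>G\<^esub> a) \<otimes>\<^bsub>G\<^esub> (g \<otimes>\<^bsub>G\<^esub> b) = inv\<^bsub>G\<^esub> a \<otimes>\<^bsub>G\<^esub> b"
        using that by (simp add: inv_mult_group m_assoc)
      then show ?thesis
        using that by (simp add: fibre)
    qed
  qed (rule Haus)
  obtain \<B> where B: "topology_base X \<B>" "weight X = |\<B>|"
    using weight_attained[of X] by blast
  obtain H where H: "subgroup H G" "closedin T H" and quotH: "quotient_map (subtopology T H) X \<phi>"
    and weightH: "weight (subtopology T H) \<le>o |(UNIV :: nat set) <+> \<B>|"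
    using exists_small_quotient_subgroup[OF assms(2) B(1)] by blast
  have HG: "H \<subseteq> carrier G"
    using H(1) by (rule subgroup.subset)
  let ?G = "G\<lparr>carrier := H\<rparr>" and ?T = "subtopology T H"
  interpret H: topological_group ?G ?T
    using H(1) by (rule subgroup_topological_group)
  have HK: "subgroup (H \<inter> K) G"
    using H(1) K(1) by (rule subgroups_Inter_pair)
  have lcos: "x <#\<^bsub>?G\<^esub> L = x <#\<^bsub>G\<^esub> L" for x L
    by (simp add: l_coset_def)
  have "coset_space_of X ?G ?T"
    unfolding coset_space_of_def
  proof (intro exI conjI)
    show "subgroup (H \<inter> K) ?G"
      using HK H(1) by (rule subgroup_incl) simp
    show "closedin ?T (H \<inter> K)"
      using K(2) closedin_subtopology by blast
    show "X homeomorphic_space coset_topology ?G ?T (H \<inter> K)"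
    proof (rule quotient_maps_same_fibres_homeomorphic[OF quotH H.quotient_map_coset_topology])
      fix a b assume "a \<in> topspace ?T" "b \<in> topspace ?T"
      then have ab: "a \<in> H" "b \<in> H" "a \<in> carrier G" "b \<in> carrier G"
        using HG by auto
      then have "inv\<^bsub>G\<^esub> a \<otimes>\<^bsub>G\<^esub> b \<in> H"
        using subgroup.m_closed[OF H(1)] subgroup.m_inv_closed[OF H(1)] by blast
      then show "\<phi> a = \<phi> b \<longleftrightarrow> a <#\<^bsub>?G\<^esub> (H \<inter> K) = b <#\<^bsub>?G\<^esub> (H \<inter> K)"
        using ab by (simp add: lcos fibre lcos_eq_iff[OF HK])
    qed
  qed
  moreover have "weight ?T \<le>o weight X" if "infinite (topspace X)"
  proof -
    have "infinite \<B>"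
      using Haus that B(1) by (rule infinite_base)
    then have "|(UNIV :: nat set) <+> \<B>| =o |\<B>|"
      by (intro card_of_Plus_infinite2) (auto simp flip: infinite_iff_card_of_nat)
    then show ?thesis
      using weightH ordLeq_ordIso_trans unfolding B(2) by blast
  qed
  moreover have "weight ?T \<le>o natLeq" if "finite (topspace X)"
  proof -
    have "\<B> \<subseteq> Pow (topspace X)"
      using B(1) openin_subset unfolding topology_base_def openin_topology_base_unique by blast
    then have "finite \<B>"
      using that finite_subset by blast
    then obtain i :: "'b set \<Rightarrow> nat" where "inj_on i \<B>"
      using finite_imp_inj_to_nat_seg by blast
    then have "|\<B>| \<le>o |UNIV :: nat set|"
      by (rule card_of_ordLeqI) simp
    then have "|(UNIV :: nat set) <+> \<B>| =o |UNIV :: nat set|"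
      by (intro card_of_Plus_infinite1) auto
    from ordLeq_ordIso_trans[OF weightH this] show ?thesis
      using card_of_nat by (rule ordLeq_ordIso_trans)
  qed
  ultimately show ?thesis
    using H completely_metrizable_space_closedin[OF assms(2)] by blast
qed

end
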